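(* Let $S \subseteq \mathsf{ISO}(\mathbb{Z}^n)$ be finite and atomic, and let $\mathcal{T}_{\langle S\rangle}$ be the group of all translations contained in $\langle S\rangle$. Let $B=[b_1,\ldots,b_m]\in\mathbb{Z}^{n\times m}$ be a basis matrix of $\mathcal{T}_{\langle S\rangle}$, let $B^\dagger := (B^\top B)^{-1}B^\top$, and define $\rho_{\mathcal{T}}:\mathbb{Z}^n\to\mathbb{Z}^n$ by $$\rho_{\mathcal{T}}(x) := x - B\lfloor B^\dagger x\rfloor,$$ where $\lfloor\cdot\rfloor$ is the coordinate-wise floor function. Then $\rho_{\mathcal{T}}$ is an orbit-representative map of the action of $\mathcal{T}_{\langle S\rangle}$ on $\mathbb{Z}^n$.
   Context: $\mathsf{ISO}(\mathbb{Z}^n)$ is the group (under composition) of all functions $h:\mathbb{Z}^n\to\mathbb{Z}^n$ preserving Euclidean distance; it and its subgroups act on $\mathbb{Z}^n$ by $h\cdot x=h(x)$. A translation is a map $t_v(x)=x+v$ with $v\in\mathbb{Z}^n$. A rotation is a map $r_R(x)=Rx$ with $R\in\mathbb{Z}^{n\times n}$, $R^\top=R^{-1}$; it is a negation if $R$ is diagonal with diagonal entries $\pm1$, and a permutation if $R$ is a permutation matrix. A subset $S\subseteq\mathsf{ISO}(\mathbb{Z}^n)$ is atomic if each of its elements is a translation, a negation or a permutation. $\langle S\rangle$ is the subgroup generated by $S$. The group $\mathcal{T}_{\langle S\rangle}$ is a free $\mathbb{Z}$-module of some rank $m\le n$; $B=[b_1,\ldots,b_m]$ is a basis matrix of it if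 $\{t_{b_1},\ldots,t_{b_m}\}$ is a $\mathbb{Z}$-basis of $\mathcal{T}_{\langle S\rangle}$. Such a $B$ has full column rank over $\mathbb{R}$, so $B^\top B$ is invertible. (If $m=0$, $\rho_{\mathcal{T}}$ is the identity.) For a group $G$ acting on a set $X$ with orbit-quotient map $q:X\to X/G$, $q(x)=G\cdot x$, a function $\rho:X\to X$ is an orbit-representative map of the action if there is a section $\overline{\rho}:X/G\to X$ of $q$ (i.e. $q\circ\overline{\rho}=\mathrm{id}_{X/G}$) with $\rho=\overline{\rho}\circ q$. *)

theory Defs
  imports
    "HOL-Algebra.Group_Action"
    "HOL-Algebra.Generated_Groups"
    "HOL-Combinatorics.Permutations"
    "Jordan_Normal_Form.Gauss_Jordan_Elimination"
begin

text \<open>\<open>\<int>\<^sup>n\<close> is \<open>carrier_vec n :: int vec set\<close>. A function on \<open>\<int>\<^sup>n\<close> is represented by its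
  extensional version (undefined outside the carrier), so that equality of HOL functions is
  equality of functions on \<open>\<int>\<^sup>n\<close>. The dimensions \<open>n\<close> and \<open>m\<close> may be zero.\<close>

definition eucl_dist :: "int vec \<Rightarrow> int vec \<Rightarrow> real" where
  "eucl_dist x y = sqrt (real_of_int ((x - y) \<bullet> (x - y)))"

definition ISO :: "nat \<Rightarrow> (int vec \<Rightarrow> int vec) monoid" where
  "ISO n = \<lparr>
     carrier = {h \<in> carrier_vec n \<rightarrow>\<^sub>E carrier_vec n.
       \<forall>x\<in>carrier_vec n. \<forall>y\<in>carrier_vec n. eucl_dist (h x) (h y) = eucl_dist x y},
     monoid.mult = compose (carrier_vec n),
     one = (\<lambda>x\<in>carrier_vec n. x)\<rparr>"

definition translation :: "nat \<Rightarrow> int vec \<Rightarrow> int vec \<Rightarrow> int vec" where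
  "translation n v = (\<lambda>x\<in>carrier_vec n. x + v)"

definition rotation :: "nat \<Rightarrow> int mat \<Rightarrow> int vec \<Rightarrow> int vec" where
  "rotation n R = (\<lambda>x\<in>carrier_vec n. R *\<^sub>v x)"

definition rotation_mat :: "nat \<Rightarrow> int mat \<Rightarrow> bool" where
  "rotation_mat n R \<longleftrightarrow>
     R \<in> carrier_mat n n \<and> inverts_mat R (transpose_mat R) \<and> inverts_mat (transpose_mat R) R"

definition permutation_mat :: "nat \<Rightarrow> int mat \<Rightarrow> bool" where
  "permutation_mat n R \<longleftrightarrow>
     (\<exists>p. p permutes {..<n} \<and> R = mat n n (\<lambda>(i, j). if i = p j then 1 else 0))"

definition is_translation :: "nat \<Rightarrow> (int vec \<Rightarrow> int vec) \<Rightarrow> bool" where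
  "is_translation n h \<longleftrightarrow> (\<exists>v\<in>carrier_vec n. h = translation n v)"

definition is_negation :: "nat \<Rightarrow> (int vec \<Rightarrow> int vec) \<Rightarrow> bool" where
  "is_negation n h \<longleftrightarrow>
     (\<exists>R. rotation_mat n R \<and> diagonal_mat R \<and> (\<forall>i<n. R $$ (i, i) \<in> {1, -1}) \<and> h = rotation n R)"

definition is_permutation :: "nat \<Rightarrow> (int vec \<Rightarrow> int vec) \<Rightarrow> bool" where
  "is_permutation n h \<longleftrightarrow> (\<exists>R. rotation_mat n R \<and> permutation_mat n R \<and> h = rotation n R)"

definition atomic :: "nat \<Rightarrow> (int vec \<Rightarrow> int vec) set \<Rightarrow> bool" where
  "atomic n S \<longleftrightarrow> (\<forall>h\<in>S. is_translation n h \<or> is_negation n h \<or> is_permutation n h)"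

definition translation_group ::
  "nat \<Rightarrow> (int vec \<Rightarrow> int vec) set \<Rightarrow> (int vec \<Rightarrow> int vec) monoid" where
  "translation_group n S = (ISO n)\<lparr>carrier := {h \<in> generate (ISO n) S. is_translation n h}\<rparr>"

text \<open>A \<open>\<int>\<close>-basis \<open>b 0, \<dots>, b (m - 1)\<close> of an abelian group written multiplicatively: the family
  spans the group and is linearly independent over \<open>\<int>\<close>.\<close>

definition int_basis :: "('a, 'b) monoid_scheme \<Rightarrow> nat \<Rightarrow> (nat \<Rightarrow> 'a) \<Rightarrow> bool" where
  "int_basis G m b \<longleftrightarrow>
     b \<in> {..<m} \<rightarrow> carrier G \<and>
     (\<forall>g\<in>carrier G. \<exists>k :: nat \<Rightarrow> int. g = finprod G (\<lambda>i. b i [^]\<^bsub>G\<^esub> k i) {..<m}) \<and>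
     (\<forall>k :: nat \<Rightarrow> int. finprod G (\<lambda>i. b i [^]\<^bsub>G\<^esub> k i) {..<m} = \<one>\<^bsub>G\<^esub> \<longrightarrow> (\<forall>i<m. k i = 0))"

definition basis_matrix ::
  "nat \<Rightarrow> nat \<Rightarrow> (int vec \<Rightarrow> int vec) set \<Rightarrow> int mat \<Rightarrow> bool" where
  "basis_matrix n m S B \<longleftrightarrow>
     B \<in> carrier_mat n m \<and> int_basis (translation_group n S) m (\<lambda>i. translation n (col B i))"

text \<open>\<open>mat_inverse\<close> returns \<open>None\<close> on singular matrices; \<open>pinv B\<close> is only meaningful when \<open>B\<close> has
  full column rank.\<close>

definition pinv :: "real mat \<Rightarrow> real mat" where
  "pinv B = the (mat_inverse (transpose_mat B * B)) * transpose_mat B"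

definition rho_T :: "int mat \<Rightarrow> int vec \<Rightarrow> int vec" where
  "rho_T B x =
     x - B *\<^sub>v map_vec floor (pinv (map_mat real_of_int B) *\<^sub>v map_vec real_of_int x)"

definition orbit_representative_map ::
  "('g, 'b) monoid_scheme \<Rightarrow> 'x set \<Rightarrow> ('g \<Rightarrow> 'x \<Rightarrow> 'x) \<Rightarrow> ('x \<Rightarrow> 'x) \<Rightarrow> bool" where
  "orbit_representative_map G X \<phi> \<rho> \<longleftrightarrow>
     group_action G X \<phi> \<and>
     (\<exists>\<rho>'. \<rho>' \<in> orbits G X \<phi> \<rightarrow> X \<and>
           (\<forall>Q\<in>orbits G X \<phi>. orbit G \<phi> (\<rho>' Q) = Q) \<and>
           (\<forall>x\<in>X. \<rho> x = \<rho>' (orbit G \<phi> x)))"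

end

theory Submission
  imports Defs "Jordan_Normal_Form.Determinant"
begin

text \<open>The translations in \<open>\<langle>S\<rangle>\<close> are exactly the \<open>t\<^bsub>Bk\<^esub>\<close> with \<open>k \<in> \<int>\<^sup>m\<close>, and \<open>\<int>\<close>-independence of
  the columns makes \<open>B\<^sup>T B\<close> nonsingular, since \<open>k\<^sup>T B\<^sup>T B k = |Bk|\<^sup>2\<close> and a singular integer matrix
  has a nonzero integer kernel vector. Hence \<open>B\<^sup>\<dagger> B = 1\<close>, so \<open>\<lfloor>B\<^sup>\<dagger> (x + Bk)\<rfloor> = \<lfloor>B\<^sup>\<dagger> x\<rfloor> + k\<close> and
  \<open>\<rho>\<close> is constant on orbits; it stays in the orbit because it subtracts a lattice vector.\<close>

section \<open>Squared length and finite balls in the integer lattice\<close>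

lemma scalar_prod_self_eq_0_iff:
  fixes v :: "int vec"
  assumes "v \<in> carrier_vec n"
  shows "v \<bullet> v = 0 \<longleftrightarrow> v = 0\<^sub>v n"
proof
  assume "v \<bullet> v = 0"
  then have "\<forall>i\<in>{0..<n}. v $ i * v $ i = 0"
    using assms by (subst sum_nonneg_eq_0_iff[symmetric]) (auto simp: scalar_prod_def)
  then show "v = 0\<^sub>v n"
    using assms by (intro eq_vecI) auto
qed (use assms in auto)

text \<open>Integrality is essential: every integer \<open>a\<close> satisfies
  \<open>\<bar>a\<bar> \<le> a * a\<close>. This bounds coordinates without taking square
  roots.\<close>

lemma abs_index_le_scalar_prod_self:
  fixes v :: "int vec"
  assumes "v \<in> carrier_vec n" "i < n"
  shows "\<bar>v $ i\<bar> \<le> v \<bullet> v"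
proof -
  have "\<bar>v $ i\<bar> \<le> v $ i * v $ i"
  proof (cases "v $ i = 0")
    case False
    then have "1 \<le> \<bar>v $ i\<bar>" by linarith
    then have "\<bar>v $ i\<bar> * 1 \<le> \<bar>v $ i\<bar> * \<bar>v $ i\<bar>" by (intro mult_left_mono) auto
    then show ?thesis by (simp add: abs_mult_self_eq)
  qed simp
  also have "\<dots> \<le> (\<Sum>j\<in>{0..<n}. v $ j * v $ j)"
    using assms(2) by (intro member_le_sum) auto
  finally show ?thesis
    using assms(1) by (simp add: scalar_prod_def)
qed

text \<open>Here \<open>r\<close> is the squared radius. Each coordinate lies within
  \<open>r\<close> of that of the centre, so the ball is contained in a finite box.\<close>

lemma finite_int_ball:
  fixes c :: "int vec" and r :: int
  assumes "c \<in> carrier_vec n"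
  shows "finite {x \<in> carrier_vec n. (x - c) \<bullet> (x - c) \<le> r}"
proof (rule finite_subset)
  let ?F = "PiE {..<n} (\<lambda>i. {c $ i - r..c $ i + r})"
  show "finite ((\<lambda>f. vec n f) ` ?F)"
    by (intro finite_imageI finite_PiE) auto
  show "{x \<in> carrier_vec n. (x - c) \<bullet> (x - c) \<le> r} \<subseteq> (\<lambda>f. vec n f) ` ?F"
  proof
    fix x assume "x \<in> {x \<in> carrier_vec n. (x - c) \<bullet> (x - c) \<le> r}"
    then have x: "x \<in> carrier_vec n" "(x - c) \<bullet> (x - c) \<le> r" by auto
    have "\<bar>x $ i - c $ i\<bar> \<le> r" if "i < n" for i
      using abs_index_le_scalar_prod_self[of "x - c" n i] x assms that by auto
    \<comment> \<open>\<open>restrict\<close> supplies the default value outside the index set that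
      \<open>PiE\<close> demands.\<close>
    then have "restrict (($) x) {..<n} \<in> ?F"
      by (auto simp: abs_le_iff) (smt (verit))+
    moreover have "x = vec n (restrict (($) x) {..<n})"
      using x by (intro eq_vecI) auto
    ultimately show "x \<in> (\<lambda>f. vec n f) ` ?F" by blast
  qed
qed

section \<open>The isometries of the lattice form a group\<close>

lemma eucl_dist_eq_iff:
  "eucl_dist x y = eucl_dist x' y' \<longleftrightarrow> (x - y) \<bullet> (x - y) = (x' - y') \<bullet> (x' - y')"
  by (simp add: eucl_dist_def)

lemma ISO_simps [simp]:
  "monoid.mult (ISO n) = compose (carrier_vec n)"
  "one (ISO n) = (\<lambda>x\<in>carrier_vec n. x)"
  by (simp_all add: ISO_def)

text \<open>Trades the real square root for integer squared lengths, so that reasoning about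
  isometries stays in \<int>.\<close>

lemma ISO_carrier_iff:
  "h \<in> carrier (ISO n) \<longleftrightarrow> h \<in> carrier_vec n \<rightarrow>\<^sub>E carrier_vec n \<and>
     (\<forall>x\<in>carrier_vec n. \<forall>y\<in>carrier_vec n. (h x - h y) \<bullet> (h x - h y) = (x - y) \<bullet> (x - y))"
  by (simp add: ISO_def eucl_dist_eq_iff)

lemma ISO_inj_on:
  assumes "h \<in> carrier (ISO n)"
  shows "inj_on h (carrier_vec n)"
proof (rule inj_onI)
  fix x y assume xy: "x \<in> carrier_vec n" "y \<in> carrier_vec n" "h x = h y"
  have "h y \<in> carrier_vec n" using assms xy by (auto simp: ISO_carrier_iff)
  then have "(x - y) \<bullet> (x - y) = 0"
    using assms xy by (force simp: ISO_carrier_iff)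
  then have "x - y = 0\<^sub>v n" using xy by (simp add: scalar_prod_self_eq_0_iff[of _ n])
  then have "x $ i - y $ i = 0" if "i < n" for i
    using xy that by (metis carrier_vecD index_minus_vec(1) index_zero_vec(1))
  then show "x = y" using xy by (intro eq_vecI) auto
qed

text \<open>An isometry \<open>h\<close> maps each ball around \<open>0\<close> injectively into the ball of the same radius around
  \<open>h 0\<close>; both are finite of the same size, so \<open>h\<close> is onto.\<close>

lemma ISO_bij_betw:
  assumes h: "h \<in> carrier (ISO n)"
  shows "bij_betw h (carrier_vec n) (carrier_vec n)"
proof -
  let ?c = "h (0\<^sub>v n)"
  have c: "?c \<in> carrier_vec n" using h by (auto simp: ISO_carrier_iff)
  have "y \<in> h ` carrier_vec n" if y: "y \<in> carrier_vec n" for y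
  proof -
    \<comment> \<open>The squared distance from \<open>y\<close> to the image of the origin, so that
      \<open>y\<close> just lies in the ball \<open>K ?c\<close>.\<close>
    define r where "r = (y - ?c) \<bullet> (y - ?c)"
    define K where "K a = {x \<in> carrier_vec n. (x - a) \<bullet> (x - a) \<le> r}" for a
    have fin: "finite (K a)" if "a \<in> carrier_vec n" for a
      unfolding K_def by (rule finite_int_ball[OF that])
    have sub: "h ` K (0\<^sub>v n) \<subseteq> K ?c"
      using h by (auto simp: K_def ISO_carrier_iff)
    have add_diff: "x + ?c - ?c = x" if "x \<in> carrier_vec n" for x
      using c that by (intro eq_vecI) auto
    \<comment> \<open>Moving the centre to the origin shows that both balls have equally many
      points; the injective image of one then fills the other.\<close>
    have "bij_betw (\<lambda>x. x - ?c) (K ?c) (K (0\<^sub>v n))"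
      by (rule bij_betw_byWitness[where f' = "\<lambda>x. x + ?c"])
        (use c in \<open>auto simp: K_def add_diff\<close>)
    then have "card (K ?c) = card (K (0\<^sub>v n))" by (rule bij_betw_same_card)
    also have "\<dots> = card (h ` K (0\<^sub>v n))"
      by (rule card_image[symmetric], rule inj_on_subset[OF ISO_inj_on[OF h]])
        (auto simp: K_def)
    finally have "h ` K (0\<^sub>v n) = K ?c"
      using card_subset_eq[OF fin[OF c] sub] by simp
    moreover have "y \<in> K ?c" using y by (simp add: K_def r_def)
    ultimately show ?thesis by (auto simp: K_def)
  qed
  moreover have "h ` carrier_vec n \<subseteq> carrier_vec n" using h by (auto simp: ISO_carrier_iff)
  ultimately show ?thesis using ISO_inj_on[OF h] by (auto simp: bij_betw_def)
qed

lemma ISO_carrier_subset_Bij: "carrier (ISO n) \<subseteq> Bij (carrier_vec n)"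
  using ISO_bij_betw by (auto simp: Bij_def ISO_carrier_iff PiE_def)

text \<open>Inverses are the substantial axiom: they exist because isometries of the lattice are
  onto.\<close>

lemma group_ISO: "group (ISO n)"
proof (rule groupI)
  fix f g h
  assume f: "f \<in> carrier (ISO n)" and g: "g \<in> carrier (ISO n)" and h: "h \<in> carrier (ISO n)"
  show "f \<otimes>\<^bsub>ISO n\<^esub> g \<otimes>\<^bsub>ISO n\<^esub> h = f \<otimes>\<^bsub>ISO n\<^esub> (g \<otimes>\<^bsub>ISO n\<^esub> h)"
    using h by (auto simp: ISO_carrier_iff PiE_def compose_assoc)
next
  fix f g assume f: "f \<in> carrier (ISO n)" and g: "g \<in> carrier (ISO n)"
  show "f \<otimes>\<^bsub>ISO n\<^esub> g \<in> carrier (ISO n)"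
    unfolding ISO_carrier_iff ISO_simps
  proof (intro conjI ballI)
    have gx: "g x \<in> carrier_vec n" if "x \<in> carrier_vec n" for x
      using g that by (auto simp: ISO_carrier_iff)
    then show "compose (carrier_vec n) f g \<in> carrier_vec n \<rightarrow>\<^sub>E carrier_vec n"
      using f by (auto simp: ISO_carrier_iff compose_def)
    fix x y :: "int vec" assume "x \<in> carrier_vec n" "y \<in> carrier_vec n"
    then show "(compose (carrier_vec n) f g x - compose (carrier_vec n) f g y) \<bullet>
        (compose (carrier_vec n) f g x - compose (carrier_vec n) f g y) = (x - y) \<bullet> (x - y)"
      using f g gx by (simp add: ISO_carrier_iff compose_eq)
  qed
next
  show "\<one>\<^bsub>ISO n\<^esub> \<in> carrier (ISO n)" by (simp add: ISO_carrier_iff)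
next
  fix f assume f: "f \<in> carrier (ISO n)"
  then show "\<one>\<^bsub>ISO n\<^esub> \<otimes>\<^bsub>ISO n\<^esub> f = f"
    by (auto simp: ISO_carrier_iff PiE_def)
  \<comment> \<open>The restriction makes the inverse extensional, as membership in
    \<open>ISO n\<close> demands.\<close>
  let ?g = "\<lambda>x\<in>carrier_vec n. inv_into (carrier_vec n) f x"
  have fB: "f \<in> Bij (carrier_vec n)" using f ISO_carrier_subset_Bij by auto
  have "compose (carrier_vec n) ?g f = (\<lambda>x\<in>carrier_vec n. x)"
    using Bij_compose_restrict_eq[OF fB] by simp
  moreover have "?g \<in> carrier (ISO n)"
    unfolding ISO_carrier_iff
  proof (intro conjI ballI)
    show "?g \<in> carrier_vec n \<rightarrow>\<^sub>E carrier_vec n"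
      using Bij_inv_into_mem[OF fB] by auto
    fix x y :: "int vec" assume xy: "x \<in> carrier_vec n" "y \<in> carrier_vec n"
    \<comment> \<open>With this, distance preservation of \<open>f\<close> at \<open>?g x\<close>
      and \<open>?g y\<close> is that of \<open>?g\<close> at \<open>x\<close> and \<open>y\<close>,
      read backwards.\<close>
    have "f (?g z) = z" "?g z \<in> carrier_vec n" if "z \<in> carrier_vec n" for z
      using that ISO_bij_betw[OF f] Bij_inv_into_mem[OF fB]
      by (auto simp: bij_betw_def f_inv_into_f)
    then show "(?g x - ?g y) \<bullet> (?g x - ?g y) = (x - y) \<bullet> (x - y)"
      using f xy unfolding ISO_carrier_iff by metis
  qed
  ultimately show "\<exists>g\<in>carrier (ISO n). g \<otimes>\<^bsub>ISO n\<^esub> f = \<one>\<^bsub>ISO n\<^esub>" by auto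
qed

section \<open>Translations as an additive copy of the lattice\<close>

lemma translation_apply [simp]: "x \<in> carrier_vec n \<Longrightarrow> translation n v x = x + v"
  by (simp add: translation_def)

lemma translation_zero: "translation n (0\<^sub>v n) = (\<lambda>x\<in>carrier_vec n. x)"
  by (auto simp: translation_def)

lemma translation_compose:
  assumes "v \<in> carrier_vec n" "w \<in> carrier_vec n"
  shows "compose (carrier_vec n) (translation n v) (translation n w) = translation n (v + w)"
proof
  fix x :: "int vec"
  show "compose (carrier_vec n) (translation n v) (translation n w) x = translation n (v + w) x"
  proof (cases "x \<in> carrier_vec n")
    case True
    then show ?thesis using assms
      by (simp add: compose_def) (intro eq_vecI, auto)
  qed (simp add: compose_def translation_def)
qed

lemma translation_eq_iff:
  assumes "v \<in> carrier_vec n" "w \<in> carrier_vec n"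
  shows "translation n v = translation n w \<longleftrightarrow> v = w"
proof
  assume "translation n v = translation n w"
  then have "translation n v (0\<^sub>v n) = translation n w (0\<^sub>v n)" by simp
  then show "v = w" using assms by simp
qed simp

lemma translation_in_ISO:
  assumes v: "v \<in> carrier_vec n"
  shows "translation n v \<in> carrier (ISO n)"
proof -
  have "x + v - (y + v) = x - y" if "x \<in> carrier_vec n" "y \<in> carrier_vec n" for x y
    using v that by (intro eq_vecI) auto
  then show ?thesis using v by (auto simp: ISO_carrier_iff translation_def)
qed

lemma inv_translation_ISO:
  assumes v: "v \<in> carrier_vec n"
  shows "inv\<^bsub>ISO n\<^esub> (translation n v) = translation n (- v)"
proof -
  interpret group "ISO n" by (rule group_ISO)
  have "translation n (- v) \<otimes>\<^bsub>ISO n\<^esub> translation n v = \<one>\<^bsub>ISO n\<^esub>"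
    using v by (simp add: translation_compose translation_zero)
  then show ?thesis
    using v by (intro inv_equality) (auto intro: translation_in_ISO)
qed

section \<open>The translation group and its action\<close>

lemma translation_group_simps [simp]:
  "monoid.mult (translation_group n S) = compose (carrier_vec n)"
  "one (translation_group n S) = (\<lambda>x\<in>carrier_vec n. x)"
  by (simp_all add: translation_group_def)

lemma translation_group_carrierE:
  assumes "h \<in> carrier (translation_group n S)"
  obtains v where "v \<in> carrier_vec n" "h = translation n v"
  using assms by (auto simp: translation_group_def is_translation_def)

lemma subgroup_translation_group:
  assumes S: "S \<subseteq> carrier (ISO n)"
  shows "subgroup (carrier (translation_group n S)) (ISO n)"
proof -
  interpret group "ISO n" by (rule group_ISO)
  interpret gen: subgroup "generate (ISO n) S" "ISO n"
    by (rule generate_is_subgroup[OF S])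
  let ?T = "{h \<in> generate (ISO n) S. is_translation n h}"
  have "subgroup ?T (ISO n)"
  proof (rule subgroup.intro)
    show "?T \<subseteq> carrier (ISO n)" using gen.subset by auto
    show "\<one>\<^bsub>ISO n\<^esub> \<in> ?T"
      using gen.one_closed translation_zero[of n] unfolding is_translation_def
      by (auto intro!: bexI[of _ "0\<^sub>v n"])
    show "x \<otimes>\<^bsub>ISO n\<^esub> y \<in> ?T" if "x \<in> ?T" "y \<in> ?T" for x y
      using that gen.m_closed[of x y]
      by (auto simp: is_translation_def translation_compose)
    show "inv\<^bsub>ISO n\<^esub> x \<in> ?T" if "x \<in> ?T" for x
      using that gen.m_inv_closed[of x]
      by (auto simp: is_translation_def inv_translation_ISO intro!: bexI[of _ "- _"])
  qed
  then show ?thesis by (simp add: translation_group_def)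
qed

text \<open>Commutativity comes from vector addition. It is what gives access to the rules for
  \<open>finprod\<close>, in terms of which \<open>int_basis\<close> is stated.\<close>

lemma comm_group_translation_group:
  assumes S: "S \<subseteq> carrier (ISO n)"
  shows "comm_group (translation_group n S)"
proof -
  interpret group "ISO n" by (rule group_ISO)
  have eq: "translation_group n S = (ISO n)\<lparr>carrier := carrier (translation_group n S)\<rparr>"
    by (simp add: translation_group_def)
  have "group (translation_group n S)"
    by (subst eq) (rule subgroup_imp_group[OF subgroup_translation_group[OF S]])
  then show ?thesis
  proof (rule group.group_comm_groupI)
    fix x y assume "x \<in> carrier (translation_group n S)" "y \<in> carrier (translation_group n S)"
    then show "x \<otimes>\<^bsub>translation_group n S\<^esub> y = y \<otimes>\<^bsub>translation_group n S\<^esub> x"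
      by (elim translation_group_carrierE) (auto simp: translation_compose comm_add_vec)
  qed
qed

text \<open>The translation group and \<open>BijGroup\<close> share the product
  \<open>compose\<close>, so the inclusion of one in the other is a homomorphism.\<close>

lemma group_action_translation_group:
  assumes S: "S \<subseteq> carrier (ISO n)"
  shows "group_action (translation_group n S) (carrier_vec n) (\<lambda>h x. h x)"
proof -
  have B: "carrier (translation_group n S) \<subseteq> Bij (carrier_vec n)"
    using subgroup.subset[OF subgroup_translation_group[OF S]] ISO_carrier_subset_Bij by blast
  then have "(\<lambda>h x. h x) \<in> hom (translation_group n S) (BijGroup (carrier_vec n))"
    by (auto simp: hom_def BijGroup_def subset_iff)
  then show ?thesis
    using comm_group.axioms(2)[OF comm_group_translation_group[OF S]] group_BijGroup
    by (intro group_action.intro group_hom.intro group_hom_axioms.intro)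
qed

lemma inv_translation:
  assumes S: "S \<subseteq> carrier (ISO n)" and v: "v \<in> carrier_vec n"
    and T: "translation n v \<in> carrier (translation_group n S)"
  shows "inv\<^bsub>translation_group n S\<^esub> (translation n v) = translation n (- v)"
  using group.m_inv_consistent[OF group_ISO subgroup_translation_group[OF S] T]
    inv_translation_ISO[OF v] by (simp add: translation_group_def)

section \<open>From multiplicative bases to integer matrices\<close>

lemma translation_int_pow:
  fixes k :: int
  assumes S: "S \<subseteq> carrier (ISO n)" and v: "v \<in> carrier_vec n"
    and T: "translation n v \<in> carrier (translation_group n S)"
  shows "translation n v [^]\<^bsub>translation_group n S\<^esub> k = translation n (k \<cdot>\<^sub>v v)"
proof -
  interpret comm_group "translation_group n S" by (rule comm_group_translation_group[OF S])
  have nat: "translation n v [^]\<^bsub>translation_group n S\<^esub> j = translation n (int j \<cdot>\<^sub>v v)" for j :: nat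
  proof (induction j)
    case 0
    have "0 \<cdot>\<^sub>v v = 0\<^sub>v n" using v by (intro eq_vecI) auto
    then show ?case by (simp add: translation_zero)
  next
    case (Suc j)
    have "int (Suc j) \<cdot>\<^sub>v v = int j \<cdot>\<^sub>v v + v" using v by (intro eq_vecI) (auto simp: algebra_simps)
    with Suc show ?case using v by (simp add: translation_compose)
  qed
  show ?thesis
  proof (cases "k < 0")
    case True
    \<comment> \<open>A negative power is the inverse of the power with exponent
      \<open>nat (- k)\<close>; \<open>inv_translation\<close> needs the latter to lie in the
      group.\<close>
    have "translation n (int (nat (- k)) \<cdot>\<^sub>v v) \<in> carrier (translation_group n S)"
      using nat_pow_closed[OF T, of "nat (- k)"] unfolding nat .
    moreover have "- (- k \<cdot>\<^sub>v v) = k \<cdot>\<^sub>v v" using v by (intro eq_vecI) auto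
    ultimately show ?thesis
      using True v inv_translation[OF S, of "- k \<cdot>\<^sub>v v"] by (simp add: int_pow_def2 nat)
  qed (simp add: int_pow_def2 nat)
qed

text \<open>The dictionary for \<open>int_basis\<close>: powers become multiples of columns and
  products become sums, so exponents turn into a coefficient vector.\<close>

lemma finprod_translation_int_pow:
  fixes k :: "nat \<Rightarrow> int"
  assumes S: "S \<subseteq> carrier (ISO n)" and B: "B \<in> carrier_mat n m"
    and T: "\<And>i. i < m \<Longrightarrow> translation n (col B i) \<in> carrier (translation_group n S)"
  shows "finprod (translation_group n S)
           (\<lambda>i. translation n (col B i) [^]\<^bsub>translation_group n S\<^esub> k i) {..<m} =
         translation n (B *\<^sub>v vec m k)"
proof -
  let ?G = "translation_group n S"
  interpret comm_group ?G by (rule comm_group_translation_group[OF S])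
  \<comment> \<open>Induction on the number of columns multiplied so far. The bound
    \<open>j \<le> m\<close> keeps every factor inside the group.\<close>
  have "finprod ?G (\<lambda>i. translation n (col B i) [^]\<^bsub>?G\<^esub> k i) {..<j} =
      translation n (vec n (\<lambda>r. \<Sum>i<j. B $$ (r, i) * k i))" if "j \<le> m" for j
    using that
  proof (induction j)
    case 0
    have "vec n (\<lambda>r. 0) = (0\<^sub>v n :: int vec)" by (intro eq_vecI) auto
    then show ?case by (simp add: translation_zero)
  next
    case (Suc j)
    then have j: "j < m" by simp
    have "k j \<cdot>\<^sub>v col B j + vec n (\<lambda>r. \<Sum>i<j. B $$ (r, i) * k i)
        = vec n (\<lambda>r. \<Sum>i<Suc j. B $$ (r, i) * k i)"
      using B j by (intro eq_vecI) auto
    moreover have "finprod ?G (\<lambda>i. translation n (col B i) [^]\<^bsub>?G\<^esub> k i) {..<Suc j} =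
        translation n (col B j) [^]\<^bsub>?G\<^esub> k j \<otimes>\<^bsub>?G\<^esub>
        finprod ?G (\<lambda>i. translation n (col B i) [^]\<^bsub>?G\<^esub> k i) {..<j}"
      unfolding lessThan_Suc using j T by (intro finprod_insert) auto
    moreover have "translation n (col B j) [^]\<^bsub>?G\<^esub> k j = translation n (k j \<cdot>\<^sub>v col B j)"
      using translation_int_pow[OF S _ T[OF j]] B by (metis carrier_matD(1) col_carrier_vec j B carrier_matD(2))
    moreover have "k j \<cdot>\<^sub>v col B j \<in> carrier_vec n" using B by auto
    ultimately show ?case using Suc j
      by (simp add: translation_compose)
  qed
  from this[of m] moreover have "vec n (\<lambda>r. \<Sum>i<m. B $$ (r, i) * k i) = B *\<^sub>v vec m k"
    using B by (intro eq_vecI) (auto simp: scalar_prod_def atLeast0LessThan)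
  ultimately show ?thesis by simp
qed

text \<open>Spanning gives one inclusion once the product of powers is read as
  \<open>B *\<^sub>v k\<close>; closure under products gives the other.\<close>

lemma translation_group_carrier_eq_lattice:
  assumes S: "S \<subseteq> carrier (ISO n)" and basis: "basis_matrix n m S B"
  shows "carrier (translation_group n S) = {translation n (B *\<^sub>v k) | k. k \<in> carrier_vec m}"
proof -
  let ?G = "translation_group n S"
  interpret comm_group ?G by (rule comm_group_translation_group[OF S])
  have B: "B \<in> carrier_mat n m" and T: "\<And>i. i < m \<Longrightarrow> translation n (col B i) \<in> carrier ?G"
    and span: "\<And>g. g \<in> carrier ?G \<Longrightarrow>
      \<exists>k :: nat \<Rightarrow> int. g = finprod ?G (\<lambda>i. translation n (col B i) [^]\<^bsub>?G\<^esub> k i) {..<m}"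
    using basis by (auto simp: basis_matrix_def int_basis_def)
  note fp = finprod_translation_int_pow[OF S B T]
  have "translation n (B *\<^sub>v k) \<in> carrier ?G" if k: "k \<in> carrier_vec m" for k
  proof -
    have "vec m (($) k) = k" using k by (intro eq_vecI) auto
    then have "translation n (B *\<^sub>v k) =
        finprod ?G (\<lambda>i. translation n (col B i) [^]\<^bsub>?G\<^esub> (k $ i)) {..<m}"
      using fp[of "($) k"] by simp
    also have "\<dots> \<in> carrier ?G" using T by (intro finprod_closed) auto
    finally show ?thesis .
  qed
  moreover have "\<exists>k\<in>carrier_vec m. g = translation n (B *\<^sub>v k)" if "g \<in> carrier ?G" for g
    using span[OF that] fp by (metis vec_carrier)
  ultimately show ?thesis by blast
qed

text \<open>If \<open>B *\<^sub>v k\<close> vanishes, the product of powers with exponents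
  \<open>k $ i\<close> is the identity, and independence kills every exponent.\<close>

lemma basis_matrix_kernel_trivial:
  assumes S: "S \<subseteq> carrier (ISO n)" and basis: "basis_matrix n m S B"
    and k: "k \<in> carrier_vec m" and Bk: "B *\<^sub>v k = 0\<^sub>v n"
  shows "k = 0\<^sub>v m"
proof -
  let ?G = "translation_group n S"
  have B: "B \<in> carrier_mat n m" and T: "\<And>i. i < m \<Longrightarrow> translation n (col B i) \<in> carrier ?G"
    and indep: "\<And>k :: nat \<Rightarrow> int. finprod ?G (\<lambda>i. translation n (col B i) [^]\<^bsub>?G\<^esub> k i) {..<m} = \<one>\<^bsub>?G\<^esub>
      \<Longrightarrow> \<forall>i<m. k i = 0"
    using basis by (auto simp: basis_matrix_def int_basis_def)
  have "vec m (($) k) = k" using k by (intro eq_vecI) auto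
  then have "finprod ?G (\<lambda>i. translation n (col B i) [^]\<^bsub>?G\<^esub> (k $ i)) {..<m} = \<one>\<^bsub>?G\<^esub>"
    using finprod_translation_int_pow[OF S B T, of "($) k"] Bk by (simp add: translation_zero)
  from indep[OF this] show ?thesis using k by (intro eq_vecI) auto
qed

section \<open>The pseudoinverse and the floor\<close>

text \<open>The hypothesis \<open>ker\<close> concerns integer vectors only, so the determinant of
  the Gram matrix is treated over \<int> first and then cast to the reals.\<close>

lemma pinv_left_inverse:
  fixes B :: "int mat"
  assumes B: "B \<in> carrier_mat n m"
    and ker: "\<And>k. k \<in> carrier_vec m \<Longrightarrow> B *\<^sub>v k = 0\<^sub>v n \<Longrightarrow> k = 0\<^sub>v m"
  defines "R \<equiv> map_mat real_of_int B"
  shows "pinv R \<in> carrier_mat m n" and "pinv R * R = 1\<^sub>m m"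
proof -
  let ?A = "transpose_mat B * B"
  have A: "?A \<in> carrier_mat m m" using B by auto
  have "det ?A \<noteq> 0"
  proof
    assume "det ?A = 0"
    then obtain v where v: "v \<in> carrier_vec m" "v \<noteq> 0\<^sub>v m" "?A *\<^sub>v v = 0\<^sub>v m"
      using det_0_iff_vec_prod_zero[OF A] by auto
    have Bv: "B *\<^sub>v v \<in> carrier_vec n" using B v by auto
    \<comment> \<open>Moving \<open>B\<close> across the scalar product brings in the Gram matrix,
      which annihilates \<open>v\<close>; hence \<open>B *\<^sub>v v\<close> has length
      zero.\<close>
    have "(B *\<^sub>v v) \<bullet> (B *\<^sub>v v) = (transpose_mat B *\<^sub>v (B *\<^sub>v v)) \<bullet> v"
      using transpose_vec_mult_scalar[OF B v(1) Bv] by simp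
    also have "transpose_mat B *\<^sub>v (B *\<^sub>v v) = 0\<^sub>v m"
      using v B by (metis assoc_mult_mat_vec transpose_carrier_mat)
    finally have "B *\<^sub>v v = 0\<^sub>v n"
      using v(1) scalar_prod_self_eq_0_iff[OF Bv] by simp
    with ker v show False by blast
  qed
  have R: "R \<in> carrier_mat n m" using B by (simp add: R_def)
  have AR: "transpose_mat R * R = map_mat real_of_int ?A"
    using B by (simp add: R_def of_int_hom.mat_hom_mult[of _ m n _ m] map_mat_transpose)
  then have "det (transpose_mat R * R) \<noteq> 0"
    using \<open>det ?A \<noteq> 0\<close> by simp
  moreover have RR: "transpose_mat R * R \<in> carrier_mat m m" using R by auto
  \<comment> \<open>A nonzero determinant over a field makes a matrix a unit, which rules out
    \<open>None\<close>. The argument \<open>()\<close> only fills the record extension of the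
    matrix ring.\<close>
  ultimately have "mat_inverse (transpose_mat R * R) \<noteq> None"
    using det_non_zero_imp_unit[OF RR, of "()"] mat_inverse(1)[OF RR, of "()"] by blast
  then obtain C where C: "mat_inverse (transpose_mat R * R) = Some C" by auto
  from mat_inverse(2)[OF RR C] have CC: "C * (transpose_mat R * R) = 1\<^sub>m m" "C \<in> carrier_mat m m"
    by auto
  have p: "pinv R = C * transpose_mat R" by (simp add: pinv_def C)
  show "pinv R \<in> carrier_mat m n" using CC R by (simp add: p)
  show "pinv R * R = 1\<^sub>m m"
    using CC R by (simp add: p assoc_mult_mat[of C m m "transpose_mat R" n R m])
qed

lemma rho_T_add_lattice:
  fixes B :: "int mat"
  assumes B: "B \<in> carrier_mat n m"
    and ker: "\<And>k. k \<in> carrier_vec m \<Longrightarrow> B *\<^sub>v k = 0\<^sub>v n \<Longrightarrow> k = 0\<^sub>v m"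
    and x: "x \<in> carrier_vec n" and k: "k \<in> carrier_vec m"
  shows "rho_T B (x + B *\<^sub>v k) = rho_T B x"
proof -
  define R where "R = map_mat real_of_int B"
  let ?P = "pinv R"
  have P: "?P \<in> carrier_mat m n" "?P * R = 1\<^sub>m m"
    using pinv_left_inverse[OF B ker] unfolding R_def by auto
  have R: "R \<in> carrier_mat n m" using B by (simp add: R_def)
  let ?x = "map_vec real_of_int x" and ?k = "map_vec real_of_int k"
  have xk: "?x \<in> carrier_vec n" "?k \<in> carrier_vec m" using x k by auto
  have "map_vec real_of_int (x + B *\<^sub>v k) = ?x + R *\<^sub>v ?k"
    unfolding R_def of_int_hom.mult_mat_vec_hom[OF B k, symmetric]
    using B x by (intro eq_vecI) auto
  then have "?P *\<^sub>v map_vec real_of_int (x + B *\<^sub>v k) = ?P *\<^sub>v ?x + ?P *\<^sub>v (R *\<^sub>v ?k)"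
    using P R xk by (simp add: mult_add_distrib_mat_vec[of _ m n])
  also have "?P *\<^sub>v (R *\<^sub>v ?k) = ?k"
    using P R xk by (metis assoc_mult_mat_vec one_mult_mat_vec)
  \<comment> \<open>The shift of the real coordinates is the integer vector \<open>k\<close>, which
    passes through the floor.\<close>
  finally have "map_vec floor (?P *\<^sub>v map_vec real_of_int (x + B *\<^sub>v k)) =
      map_vec floor (?P *\<^sub>v ?x) + k"
    using P k by (intro eq_vecI) auto
  moreover have "map_vec floor (?P *\<^sub>v ?x) \<in> carrier_vec m"
    using mult_mat_vec_carrier[OF P(1) xk(1)] by simp
  ultimately have "rho_T B (x + B *\<^sub>v k) = x + B *\<^sub>v k - (B *\<^sub>v map_vec floor (?P *\<^sub>v ?x) + B *\<^sub>v k)"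
    using B k by (simp add: rho_T_def R_def[symmetric] mult_add_distrib_mat_vec[of _ n m])
  also have "\<dots> = rho_T B x"
    using B k x by (intro eq_vecI) (auto simp: rho_T_def R_def)
  finally show ?thesis .
qed

section \<open>Orbit representatives from invariance\<close>

text \<open>Constancy on orbits lets \<open>\<rho>\<close> factor through the quotient; staying
  inside the orbit makes the factor a section.\<close>

lemma (in group_action) orbit_representative_mapI:
  assumes mem: "\<And>x. x \<in> E \<Longrightarrow> \<rho> x \<in> orbit G \<phi> x"
    and inv: "\<And>g x. g \<in> carrier G \<Longrightarrow> x \<in> E \<Longrightarrow> \<rho> (\<phi> g x) = \<rho> x"
  shows "orbit_representative_map G E \<phi> \<rho>"
  unfolding orbit_representative_map_def
proof (intro conjI exI)
  \<comment> \<open>The section evaluates \<open>\<rho>\<close> at an arbitrary point of the orbit;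
    by \<open>inv\<close> the choice does not affect the value.\<close>
  let ?r = "\<lambda>Q. \<rho> (SOME x. x \<in> Q)"
  have sub: "orbit G \<phi> x \<subseteq> E" if "x \<in> E" for x
    using that element_image by (auto simp: orbit_def)
  have r: "?r (orbit G \<phi> x) = \<rho> x" if "x \<in> E" for x
  proof -
    have "(SOME y. y \<in> orbit G \<phi> x) \<in> orbit G \<phi> x"
      using orbit_refl[OF that] by (rule someI)
    then show ?thesis using inv that by (auto simp: orbit_def)
  qed
  have eq: "orbit G \<phi> (\<rho> x) = orbit G \<phi> x" if x: "x \<in> E" for x
  proof -
    have rx: "\<rho> x \<in> E" using mem sub x by blast
    show ?thesis
      using orbit_trans[OF x rx _ mem[OF x]] orbit_trans[OF rx x _ orbit_sym[OF x rx mem[OF x]]]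
        sub[OF x] sub[OF rx] by blast
  qed
  show "group_action G E \<phi>" by (rule group_action_axioms)
  show "?r \<in> orbits G E \<phi> \<rightarrow> E" using r mem sub by (fastforce simp: orbits_def)
  show "\<forall>Q\<in>orbits G E \<phi>. orbit G \<phi> (?r Q) = Q" using r eq by (auto simp: orbits_def)
  show "\<forall>x\<in>E. \<rho> x = ?r (orbit G \<phi> x)" using r by simp
qed

theorem theorem9p1:
  fixes n m :: nat
    and S :: "(int vec \<Rightarrow> int vec) set"
    and B :: "int mat"
  assumes "S \<subseteq> carrier (ISO n)"
    and "finite S"
    and "atomic n S"
    and "basis_matrix n m S B"
  shows "orbit_representative_map (translation_group n S) (carrier_vec n) (\<lambda>h x. h x) (rho_T B)"
proof -
  interpret group_action "translation_group n S" "carrier_vec n" "\<lambda>h x. h x"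
    by (rule group_action_translation_group[OF assms(1)])
  note car = translation_group_carrier_eq_lattice[OF assms(1,4)]
  note ker = basis_matrix_kernel_trivial[OF assms(1,4)]
  have B: "B \<in> carrier_mat n m" using assms(4) by (simp add: basis_matrix_def)
  \<comment> \<open>Turns the subtraction in \<open>rho_T\<close> into a lattice translation, the
    form in which \<open>car\<close> lists the group elements.\<close>
  have sub: "x - B *\<^sub>v k = x + B *\<^sub>v (- k)" if "x \<in> carrier_vec n" "k \<in> carrier_vec m" for x k
    using B that by (intro eq_vecI) auto
  show ?thesis
  proof (rule orbit_representative_mapI)
    fix x :: "int vec" assume x: "x \<in> carrier_vec n"
    let ?k = "map_vec floor (pinv (map_mat real_of_int B) *\<^sub>v map_vec real_of_int x)"
    have k: "?k \<in> carrier_vec m"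
      using mult_mat_vec_carrier[OF pinv_left_inverse(1)[OF B ker]] x by simp
    \<comment> \<open>The group element carrying \<open>x\<close> to its representative has
      coordinates \<open>- ?k\<close> in the basis.\<close>
    have "rho_T B x = translation n (B *\<^sub>v (- ?k)) x"
      using x k sub[OF x k] by (simp add: rho_T_def)
    moreover have "- ?k \<in> carrier_vec m" using k by simp
    ultimately show "rho_T B x \<in> orbit (translation_group n S) (\<lambda>h x. h x) x"
      unfolding orbit_def car by blast
  next
    fix g and x :: "int vec"
    assume "g \<in> carrier (translation_group n S)" and x: "x \<in> carrier_vec n"
    then obtain k where "k \<in> carrier_vec m" "g = translation n (B *\<^sub>v k)"
      by (auto simp: car)
    then show "rho_T B (g x) = rho_T B x"
      using rho_T_add_lattice[OF B ker x] x by simp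
  qed
qed

end
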